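(* Let $n$ and $r$ be integers with $1 \leq r \leq n-1$, let $T_n$ be the depth-two claw with $n$ leaves, and let ${\mathcal{I}_{T_n}}^{(r)}$ be the family of all $r$-element independent sets of $T_n$. Then ${\mathcal{I}_{T_n}}^{(r)}$ has the star property; that is, there is a vertex $v$ of $T_n$ such that the family $\{A \in {\mathcal{I}_{T_n}}^{(r)} \colon v \in A\}$ is non-empty and has size at least $|\mathcal{E}|$ for every intersecting subfamily $\mathcal{E}$ of ${\mathcal{I}_{T_n}}^{(r)}$.
   Context: The depth-two claw $T_n$ is the graph with $2n+1$ distinct vertices $x_0, x_1, \dots, x_n, y_1, \dots, y_n$ and edge set $\{x_0y_1, \dots, x_0y_n, x_1y_1, \dots, x_ny_n\}$. A set $I$ of vertices of a graph $G$ is an independent set of $G$ if no two vertices in $I$ are adjacent in $G$. A family $\mathcal{E}$ of sets is intersecting if $A \cap B \neq \emptyset$ for every $A, B \in \mathcal{E}$ (including the case $A = B$). For a family $\mathcal{F}$ of subsets of a set $X$ and $x \in X$, the family $\mathcal{F}(x) = \{F \in \mathcal{F} \colon x \in F\}$ is called a star of $\mathcal{F}$ if it is non-empty. A family $\mathcal{F}$ has the star property if at least one of the largest (by cardinality) intersecting subfamilies of $\mathcal{F}$ is a star of $\mathcal{F}$. *)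

theory Defs
  imports Main
begin

text \<open>A graph is a pair of a vertex set and a set of edges, where the undirected edge
  joining \<open>u\<close> and \<open>v\<close> is the two-element set \<open>{u, v}\<close>.\<close>

type_synonym 'a ugraph = "'a set \<times> 'a set set"

definition verts :: "'a ugraph \<Rightarrow> 'a set" where
  "verts G = fst G"

definition edges :: "'a ugraph \<Rightarrow> 'a set set" where
  "edges G = snd G"

definition adjacent :: "'a ugraph \<Rightarrow> 'a \<Rightarrow> 'a \<Rightarrow> bool" where
  "adjacent G u v \<longleftrightarrow> {u, v} \<in> edges G"

definition independent_set :: "'a ugraph \<Rightarrow> 'a set \<Rightarrow> bool" where
  "independent_set G I \<longleftrightarrow>
     I \<subseteq> verts G \<and> (\<forall>u\<in>I. \<forall>v\<in>I. u \<noteq> v \<longrightarrow> \<not> adjacent G u v)"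

text \<open>All graphs considered are finite. For \<open>r = 0\<close> on an infinite graph, \<^const>\<open>card\<close>
  would also admit infinite sets, hence the explicit finiteness condition.\<close>

definition independent_sets :: "'a ugraph \<Rightarrow> nat \<Rightarrow> 'a set set" where
  "independent_sets G r = {I. independent_set G I \<and> finite I \<and> card I = r}"

definition intersecting :: "'a set set \<Rightarrow> bool" where
  "intersecting \<E> \<longleftrightarrow> (\<forall>A\<in>\<E>. \<forall>B\<in>\<E>. A \<inter> B \<noteq> {})"

definition members_with :: "'a set set \<Rightarrow> 'a \<Rightarrow> 'a set set" where
  "members_with \<F> x = {F \<in> \<F>. x \<in> F}"

text \<open>No ground set is mentioned: non-emptiness forces \<open>x\<close> to lie in a member of \<open>\<F>\<close>.\<close>

definition is_star :: "'a set set \<Rightarrow> 'a set set \<Rightarrow> bool" where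
  "is_star \<F> \<S> \<longleftrightarrow> \<S> \<noteq> {} \<and> (\<exists>x. \<S> = members_with \<F> x)"

text \<open>The next two notions are meant for finite \<open>\<F>\<close>, where \<^const>\<open>card\<close> is the
  true cardinality of every subfamily.\<close>

definition largest_intersecting :: "'a set set \<Rightarrow> 'a set set \<Rightarrow> bool" where
  "largest_intersecting \<F> \<E> \<longleftrightarrow>
     \<E> \<subseteq> \<F> \<and> intersecting \<E> \<and>
     (\<forall>\<E>'. \<E>' \<subseteq> \<F> \<and> intersecting \<E>' \<longrightarrow> card \<E>' \<le> card \<E>)"

definition star_property :: "'a set set \<Rightarrow> bool" where
  "star_property \<F> \<longleftrightarrow> (\<exists>\<S>. largest_intersecting \<F> \<S> \<and> is_star \<F> \<S>)"

text \<open>Constructors of a datatype make the vertices \<open>x\<^sub>0, \<dots>, x\<^sub>n, y\<^sub>1, \<dots>, y\<^sub>n\<close> distinct.\<close>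

datatype claw_vertex = X nat | Y nat

definition depth_two_claw :: "nat \<Rightarrow> claw_vertex ugraph" where
  "depth_two_claw n =
     (X ` {0..n} \<union> Y ` {1..n},
      (\<lambda>i. {X 0, Y i}) ` {1..n} \<union> (\<lambda>i. {X i, Y i}) ` {1..n})"

end

theory Submission
  imports Defs Complex_Main "HOL-Combinatorics.Permutations"
begin

text \<open>
  The star at the leaf \<open>X 1\<close> is a largest intersecting family. The proof compresses the
  problem to a weighted one about subsets of \<open>V = {1..n}\<close>.

  Replacing \<open>Y i\<close> by \<open>X i\<close> is a compression that keeps cardinality and intersection
  (\<open>exists_compressed_family\<close>), and in a family closed under these replacements any two
  members already share some \<open>X i\<close> (\<open>compressed_families_share_X\<close>). Hence only the set
  \<open>P\<close> of indices of the \<open>X\<close>-vertices of a member matters. A member that avoids the root \<open>X 0\<close> has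
  \<open>P \<subseteq> V\<close>, and \<open>P\<close> arises from \<open>w(|P|) = (n - |P|) choose (n - r)\<close> independent sets,
  one for each choice of the \<open>Y\<close>-vertices (\<open>card_fiber\<close>); a member that contains the root is
  determined by \<open>P\<close>, that is, by the \<open>(r - 1)\<close>-set \<open>P - {0}\<close>. What remains is an intersecting family
  \<open>\<P>\<close> of subsets of \<open>V\<close> weighted by \<open>w\<close>, and a family \<open>\<A>\<close> of \<open>(r - 1)\<close>-sets of weight \<open>1\<close>
  each, not necessarily intersecting, but each meeting every member of \<open>\<P>\<close>. The claim is that the
  total weight is largest when both consist of all sets through a fixed point
  (\<open>weighted_star_bound\<close>).

  Let \<open>D(p)\<close> be the amount by which level \<open>p\<close> of the star exceeds level \<open>p\<close> of \<open>\<P>\<close>. The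
  Erdos-Ko-Rado theorem (proved with Katona's cycle) says \<open>D(p) \<ge> 0\<close> for \<open>2p \<le> n\<close>, and
  complementation says \<open>D(p) + D(n - p) \<ge> 0\<close> for all \<open>p\<close>. As \<open>w\<close> is decreasing, these give
  \<open>\<Sum>p. w(p) D(p) \<ge> 0\<close>; the surplus of \<open>\<A>\<close> over its star has to be paid out of this sum.

  \<^item> If \<open>2r \<le> n + 1\<close>, level \<open>r\<close> pays: adding a new point \<open>z\<close> to the members of \<open>\<A>\<close> turns
    \<open>\<A>\<close> and level \<open>r\<close> of \<open>\<P>\<close> into one intersecting family of \<open>r\<close>-sets on \<open>n + 1\<close> points, to
    which Erdos-Ko-Rado applies.
  \<^item> If \<open>2r > n + 1\<close>, level \<open>m = n - r + 1\<close> pays: no member of \<open>\<A>\<close> is the complement of a member of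
    \<open>\<P>\<close>, so the surplus of \<open>\<A>\<close> is at most \<open>D(m)\<close>. One unit of the weight of level \<open>m\<close> is
    spent, and the remaining weights still decrease from \<open>p\<close> to \<open>n - p\<close>, because \<open>r < n\<close>
    makes \<open>w(m) > w(n - m)\<close> whenever \<open>m < n - m\<close>.
\<close>

section \<open>The Erdos-Ko-Rado theorem\<close>

text \<open>The points of the cycle are the residues \<open>0, \<dots>, n - 1\<close>, taken as integers so that the
  offset \<open>x - i\<close> of a point from the start \<open>i\<close> of the arc may be negative before reduction.\<close>

definition arc :: "nat \<Rightarrow> nat \<Rightarrow> int \<Rightarrow> int set" where
  "arc n p i = {x \<in> {0..<int n}. (x - i) mod int n < int p}"

lemma card_arc:
  assumes "p \<le> n"
  shows "card (arc n p i) = p"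
proof -
  have "bij_betw (\<lambda>k. (i + k) mod int n) {0..<int p} (arc n p i)"
    unfolding bij_betw_def
  proof
    have "k = ((i + k) mod int n - i) mod int n" if "0 \<le> k" "k < int p" for k
      using that assms by (simp add: mod_simps)
    then show "inj_on (\<lambda>k. (i + k) mod int n) {0..<int p}"
      by (smt (verit, best) atLeastLessThan_iff inj_onI)
    show "(\<lambda>k. (i + k) mod int n) ` {0..<int p} = arc n p i"
    proof (intro equalityI subsetI)
      fix x assume "x \<in> (\<lambda>k. (i + k) mod int n) ` {0..<int p}"
      then show "x \<in> arc n p i"
        using assms by (auto simp: arc_def mod_simps)
    next
      fix x assume x: "x \<in> arc n p i"
      then have "x = (i + (x - i) mod int n) mod int n"
        by (simp add: arc_def mod_simps)
      moreover have "(x - i) mod int n \<in> {0..<int p}"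
        using x by (auto simp: arc_def)
      ultimately show "x \<in> (\<lambda>k. (i + k) mod int n) ` {0..<int p}"
        by blast
    qed
  qed
  then show ?thesis
    by (metis bij_betw_same_card card_atLeastLessThan_int diff_zero nat_int)
qed

text \<open>Katona's observation. Measured from a fixed start \<open>a \<in> J\<close>, every other start lies at
  an offset below \<open>p\<close> or above \<open>n - p\<close>. Offsets \<open>t\<close> and \<open>n - p + t\<close> belong to two arcs of which one
  ends just before the other starts; these are disjoint because \<open>2p \<le> n\<close>. So
  reducing the offsets above \<open>n - p\<close> by \<open>n - p\<close> maps \<open>J\<close> injectively into \<open>{0..<p}\<close>.\<close>

lemma card_intersecting_arcs:
  assumes "2 * p \<le> n" and J: "J \<subseteq> {0..<int n}"
    and meet: "\<And>i j. i \<in> J \<Longrightarrow> j \<in> J \<Longrightarrow> arc n p i \<inter> arc n p j \<noteq> {}"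
  shows "card J \<le> p"
proof (cases "J = {}")
  case False
  then obtain a where a: "a \<in> J" by blast
  define d where "d j = (j - a) mod int n" for j
  define h where "h j = (if d j < int p then d j else d j + int p - int n)" for j
  have n: "0 < int n" using a J by auto
  have diff: "\<exists>u v. 0 \<le> u \<and> u < int p \<and> 0 \<le> v \<and> v < int p \<and> (j - i) mod int n = (u - v) mod int n"
    if ij: "i \<in> J" "j \<in> J" for i j
  proof -
    obtain x where "x \<in> arc n p i" "x \<in> arc n p j" using meet[OF ij] by blast
    then have "(x - i) mod int n < int p" "(x - j) mod int n < int p"
      by (auto simp: arc_def)
    moreover have "(j - i) mod int n = ((x - i) mod int n - (x - j) mod int n) mod int n"
      by (simp add: mod_simps)
    ultimately show ?thesis using n by (meson pos_mod_sign)
  qed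
  have wrap: "(u - v) mod int n = (if v \<le> u then u - v else u - v + int n)"
    if "0 \<le> u" "u < int p" "0 \<le> v" "v < int p" for u v
  proof (cases "v \<le> u")
    case True
    then show ?thesis using that assms(1) by simp
  next
    case False
    then have "(u - v + int n) mod int n = u - v + int n"
      using that assms(1) by (intro mod_pos_pos_trivial) linarith+
    then show ?thesis using False by simp
  qed
  have d: "0 \<le> d j" "d j < int p \<or> int n - int p < d j" "d j < int n" if "j \<in> J" for j
    using diff[OF a that] wrap n unfolding d_def by (auto split: if_splits)
  have d_inj: "i = j" if "i \<in> J" "j \<in> J" "d i = d j" for i j
  proof -
    have "i mod int n = j mod int n"
      using that(3) unfolding d_def by (metis diff_add_cancel mod_add_left_eq)
    then show ?thesis using that J by (auto simp: subset_iff)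
  qed
  have sep: "d j - d i \<noteq> int n - int p" if ij: "i \<in> J" "j \<in> J" for i j
  proof
    assume "d j - d i = int n - int p"
    moreover have "(j - i) mod int n = (d j - d i) mod int n"
      by (simp add: d_def mod_simps)
    moreover have "0 < p" using diff[OF ij] by auto
    ultimately have "(j - i) mod int n = int n - int p"
      using assms(1) by (simp add: zmod_zminus1_eq_if)
    then show False using diff[OF ij] wrap assms(1) by (auto split: if_splits)
  qed
  have "inj_on h J"
  proof (rule inj_onI)
    fix i j assume ij: "i \<in> J" "j \<in> J" "h i = h j"
    then have "d i = d j"
      using sep[of i j] sep[of j i] unfolding h_def by (auto split: if_splits)
    then show "i = j" using ij d_inj by blast
  qed
  moreover have "h ` J \<subseteq> {0..<int p}"
    using d by (force simp: h_def)
  ultimately have "card J \<le> card {0..<int p}"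
    by (meson card_inj_on_le finite_atLeastLessThan_int)
  then show ?thesis by simp
qed simp

text \<open>A uniformly random permutation sends \<open>S\<close> to a uniformly random subset of the same size:
  composing with a permutation that takes \<open>S\<close> to \<open>T\<close> shows that each \<open>T\<close> is hit equally
  often, and all these \<open>T\<close> together account for all permutations.\<close>

lemma card_permutes_image_in:
  assumes "finite V" "S \<subseteq> V" and F: "\<And>P. P \<in> \<F> \<Longrightarrow> P \<subseteq> V \<and> card P = card S"
  shows "card {\<pi>. \<pi> permutes V \<and> \<pi> ` S \<in> \<F>} * (card V choose card S) = fact (card V) * card \<F>"
proof -
  define N where "N T = {\<pi>. \<pi> permutes V \<and> \<pi> ` S = T}" for T
  have finN: "finite (N T)" for T
    unfolding N_def by (rule finite_subset[OF _ finite_permutations[OF assms(1)]]) blast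
  have N: "card (N T) = card (N S)" if T: "T \<subseteq> V" "card T = card S" for T
  proof -
    have fin: "finite S" "finite T" using assms(1,2) T(1) finite_subset by blast+
    obtain f where f: "bij_betw f S T"
      using fin T finite_same_card_bij by metis
    have "card (V - S) = card (V - T)"
      using fin T assms by (simp add: card_Diff_subset)
    then obtain g where g: "bij_betw g (V - S) (V - T)"
      using assms(1) finite_same_card_bij by (metis finite_Diff)
    \<comment> \<open>a permutation of \<open>V\<close> that takes \<open>S\<close> to \<open>T\<close>\<close>
    define s where "s x = (if x \<in> S then f x else if x \<in> V then g x else x)" for x
    have sS: "bij_betw s S T"
      using f by (rule bij_betw_cong[THEN iffD1, rotated]) (auto simp: s_def)
    have "bij_betw s (V - S) (V - T)"
      using g by (rule bij_betw_cong[THEN iffD1, rotated]) (auto simp: s_def)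
    then have "bij_betw s (S \<union> (V - S)) (T \<union> (V - T))"
      using sS by (intro bij_betw_combine) auto
    then have s: "s permutes V"
      using assms T by (intro bij_imp_permutes) (auto simp: s_def Un_absorb1)
    have sST: "s ` S = T" using sS by (simp add: bij_betw_def)
    have invT: "inv s ` T = S"
      using sST s by (metis image_inv_f_f permutes_inj)
    have image_o: "(g \<circ> h) ` S = g ` h ` S" for g h :: "'a \<Rightarrow> 'a"
      by (simp add: image_image)
    have "bij_betw (\<lambda>\<pi>. s \<circ> \<pi>) (N S) (N T)"
    proof (rule bij_betwI[where g = "\<lambda>\<pi>. inv s \<circ> \<pi>"])
      show "(\<lambda>\<pi>. s \<circ> \<pi>) \<in> N S \<rightarrow> N T"
      proof
        fix \<pi> assume "\<pi> \<in> N S"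
        then have \<pi>: "\<pi> permutes V" "\<pi> ` S = S" by (simp_all add: N_def)
        have "(s \<circ> \<pi>) ` S = T" unfolding image_o \<pi>(2) by (rule sST)
        moreover have "s \<circ> \<pi> permutes V" using \<pi>(1) s by (intro permutes_compose)
        ultimately show "s \<circ> \<pi> \<in> N T" by (simp add: N_def)
      qed
      show "(\<lambda>\<pi>. inv s \<circ> \<pi>) \<in> N T \<rightarrow> N S"
      proof
        fix \<pi> assume "\<pi> \<in> N T"
        then have \<pi>: "\<pi> permutes V" "\<pi> ` S = T" by (simp_all add: N_def)
        have "(inv s \<circ> \<pi>) ` S = S" unfolding image_o \<pi>(2) by (rule invT)
        moreover have "inv s \<circ> \<pi> permutes V" using \<pi>(1) s by (intro permutes_compose permutes_inv)
        ultimately show "inv s \<circ> \<pi> \<in> N S" by (simp add: N_def)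
      qed
      show "inv s \<circ> (s \<circ> \<pi>) = \<pi>" for \<pi>
        using s by (simp add: o_assoc permutes_inv_o)
      show "s \<circ> (inv s \<circ> \<pi>) = \<pi>" for \<pi>
        using s by (simp add: o_assoc permutes_inv_o)
    qed
    then show ?thesis by (simp add: bij_betw_same_card)
  qed
  have count: "card {\<pi>. \<pi> permutes V \<and> \<pi> ` S \<in> \<G>} = card \<G> * card (N S)"
    if G: "\<And>P. P \<in> \<G> \<Longrightarrow> P \<subseteq> V \<and> card P = card S" for \<G>
  proof -
    have "\<G> \<subseteq> Pow V" using G by blast
    then have fin: "finite \<G>" using assms(1) finite_subset by blast
    have "{\<pi>. \<pi> permutes V \<and> \<pi> ` S \<in> \<G>} = (\<Union>T\<in>\<G>. N T)" by (auto simp: N_def)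
    also have "card \<dots> = (\<Sum>T\<in>\<G>. card (N T))"
      using fin finN by (intro card_UN_disjoint) (auto simp: N_def)
    also have "\<dots> = (\<Sum>T\<in>\<G>. card (N S))" by (intro sum.cong refl N) (use G in auto)
    finally show ?thesis by simp
  qed
  have "{\<pi>. \<pi> permutes V \<and> \<pi> ` S \<in> {T. T \<subseteq> V \<and> card T = card S}} = {\<pi>. \<pi> permutes V}"
    using assms(2) by (auto simp: permutes_image card_image permutes_inj_on dest: permutes_in_image)
  then have "fact (card V) = (card V choose card S) * card (N S)"
    using count[of "{T. T \<subseteq> V \<and> card T = card S}"] assms(1)
    by (simp add: card_permutations n_subsets)
  then show ?thesis using count[OF F] by simp
qed

text \<open>Count pairs of a permutation of \<open>V\<close>, laid out on the cycle, and an arc whose image lies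
  in \<open>\<F>\<close>. Each permutation has at most \<open>p\<close> such arcs, and each of the \<open>n\<close> arcs
  has its image in \<open>\<F>\<close> for the proportion \<open>card \<F> / (n choose p)\<close> of all permutations. The bound
  \<open>p / n * (n choose p)\<close> is the number of \<open>p\<close>-sets through a given point; this form needs no
  case distinction at \<open>p = 0\<close>.\<close>

theorem Erdos_Ko_Rado:
  assumes V: "finite V" and p: "2 * p \<le> card V"
    and F: "\<F> \<subseteq> {P. P \<subseteq> V \<and> card P = p}" and int: "intersecting \<F>"
  shows "card V * card \<F> \<le> p * (card V choose p)"
proof -
  define n where "n = card V"
  define Perms where "Perms = {\<pi>. \<pi> permutes V}"
  have "card {0..<int n} = card V" by (simp add: n_def)
  then obtain e where e: "bij_betw e {0..<int n} V"
    using V finite_same_card_bij by blast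
  have arc_sub: "arc n p i \<subseteq> {0..<int n}" for i by (auto simp: arc_def)
  have arcV: "e ` arc n p i \<subseteq> V" for i
    using arc_sub e by (metis bij_betw_def image_mono)
  have card_arcV: "card (e ` arc n p i) = p" for i
    using arc_sub e p by (metis bij_betw_def card_arc card_image inj_on_subset mult_2 n_def trans_le_add1 le_trans le_add1)
  have fin: "finite Perms" using V by (simp add: Perms_def finite_permutations)
  have few: "card {i \<in> {0..<int n}. \<pi> ` e ` arc n p i \<in> \<F>} \<le> p" if \<pi>: "\<pi> \<in> Perms" for \<pi>
  proof (rule card_intersecting_arcs)
    fix i j assume "i \<in> {i \<in> {0..<int n}. \<pi> ` e ` arc n p i \<in> \<F>}"
      and "j \<in> {i \<in> {0..<int n}. \<pi> ` e ` arc n p i \<in> \<F>}"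
    then have "\<pi> ` e ` arc n p i \<inter> \<pi> ` e ` arc n p j \<noteq> {}"
      using int by (auto simp: intersecting_def)
    moreover have "inj \<pi>" using \<pi> permutes_inj by (auto simp: Perms_def)
    ultimately have "e ` arc n p i \<inter> e ` arc n p j \<noteq> {}"
      by (simp add: image_Int[symmetric])
    then show "arc n p i \<inter> arc n p j \<noteq> {}"
      using e arc_sub inj_on_image_Int by (metis bij_betw_def image_empty)
  qed (use p n_def in auto)
  have each: "card {\<pi> \<in> Perms. \<pi> ` e ` arc n p i \<in> \<F>} * (n choose p) = fact n * card \<F>" for i
    using card_permutes_image_in[OF V arcV, of \<F> i] F card_arcV[of i]
    by (auto simp: Perms_def n_def)
  have "(\<Sum>i\<in>{0..<int n}. card {\<pi> \<in> Perms. \<pi> ` e ` arc n p i \<in> \<F>})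
      = (\<Sum>\<pi>\<in>Perms. card {i \<in> {0..<int n}. \<pi> ` e ` arc n p i \<in> \<F>})"
    using fin by (intro sum_multicount_gen) auto
  also have "\<dots> \<le> (\<Sum>\<pi>\<in>Perms. p)" by (intro sum_mono few)
  also have "\<dots> = p * fact n" using V by (simp add: Perms_def n_def card_permutations)
  finally have "(\<Sum>i\<in>{0..<int n}. card {\<pi> \<in> Perms. \<pi> ` e ` arc n p i \<in> \<F>}) * (n choose p)
      \<le> p * fact n * (n choose p)"
    by (rule mult_right_mono) simp
  moreover have "(\<Sum>i\<in>{0..<int n}. card {\<pi> \<in> Perms. \<pi> ` e ` arc n p i \<in> \<F>}) * (n choose p)
      = n * (fact n * card \<F>)"
    unfolding sum_distrib_right each by simp
  ultimately have "fact n * (n * card \<F>) \<le> fact n * (p * (n choose p))"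
    by (simp only: mult_ac)
  then have "n * card \<F> \<le> p * (n choose p)"
    by (rule mult_left_le_imp_le) simp
  then show ?thesis by (simp add: n_def)
qed

section \<open>Cross-intersecting families on two levels\<close>

text \<open>The complement of a member of \<open>\<B>\<close> has size \<open>a\<close>, and it is not a member of \<open>\<A>\<close>, so \<open>\<A>\<close> and
  the complements of \<open>\<B>\<close> are disjoint parts of one level.\<close>

lemma cross_intersecting_complementary_levels:
  assumes V: "finite V" "a + b = card V"
    and A: "\<A> \<subseteq> {A. A \<subseteq> V \<and> card A = a}" and B: "\<B> \<subseteq> {B. B \<subseteq> V \<and> card B = b}"
    and cross: "\<And>A B. A \<in> \<A> \<Longrightarrow> B \<in> \<B> \<Longrightarrow> A \<inter> B \<noteq> {}"
  shows "card \<A> + card \<B> \<le> card V choose a"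
proof -
  have fin: "finite {A. A \<subseteq> V \<and> card A = a}" "finite {B. B \<subseteq> V \<and> card B = b}"
    using V(1) by simp_all
  have "inj_on (\<lambda>B. V - B) \<B>"
    using B by (intro inj_onI) blast
  then have "card \<A> + card \<B> = card \<A> + card ((\<lambda>B. V - B) ` \<B>)"
    by (simp add: card_image)
  also have "\<dots> = card (\<A> \<union> (\<lambda>B. V - B) ` \<B>)"
  proof (rule card_Un_disjoint[symmetric])
    show "finite \<A>" "finite ((\<lambda>B. V - B) ` \<B>)"
      using fin A B finite_subset by blast+
    show "\<A> \<inter> (\<lambda>B. V - B) ` \<B> = {}" using cross by blast
  qed
  also have "\<dots> \<le> card {A. A \<subseteq> V \<and> card A = a}"
  proof (rule card_mono[OF fin(1)])
    have "card (V - B) = a" if "B \<in> \<B>" for B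
      using that B V by (auto simp: card_Diff_subset finite_subset)
    then show "\<A> \<union> (\<lambda>B. V - B) ` \<B> \<subseteq> {A. A \<subseteq> V \<and> card A = a}"
      using A by auto
  qed
  also have "\<dots> = card V choose a" using V(1) by (rule n_subsets)
  finally show ?thesis .
qed

text \<open>Adding the new point \<open>z\<close> to every member of \<open>\<A>\<close> makes \<open>\<A>\<close> intersecting and lifts it to the
  level of \<open>\<B>\<close>. The union is an intersecting family on one point more, and the bound is
  the size of the star at \<open>z\<close>.\<close>

lemma cross_intersecting_consecutive_levels:
  assumes V: "finite V" "z \<notin> V" and r: "2 * Suc k \<le> Suc (card V)"
    and A: "\<A> \<subseteq> {A. A \<subseteq> V \<and> card A = k}" and B: "\<B> \<subseteq> {B. B \<subseteq> V \<and> card B = Suc k}"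
    and int: "intersecting \<B>"
    and cross: "\<And>A B. A \<in> \<A> \<Longrightarrow> B \<in> \<B> \<Longrightarrow> A \<inter> B \<noteq> {}"
  shows "card \<A> + card \<B> \<le> card V choose k"
proof -
  have fin: "finite {A. A \<subseteq> V \<and> card A = k}" "finite {B. B \<subseteq> V \<and> card B = Suc k}"
    using V(1) by simp_all
  have finV: "finite A" if "A \<subseteq> V" for A using that V(1) finite_subset by blast
  have z: "z \<notin> A" if "A \<in> \<A> \<union> \<B>" for A using that A B V(2) by blast
  have "inj_on (insert z) \<A>"
    using z by (intro inj_onI) (metis Un_iff insert_ident)
  then have "card \<A> + card \<B> = card (insert z ` \<A>) + card \<B>"
    by (simp add: card_image)
  also have "\<dots> = card (insert z ` \<A> \<union> \<B>)"
  proof (rule card_Un_disjoint[symmetric])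
    show "finite (insert z ` \<A>)" "finite \<B>"
      using fin A B finite_subset by blast+
    show "insert z ` \<A> \<inter> \<B> = {}" using z by blast
  qed
  finally have eq: "card \<A> + card \<B> = card (insert z ` \<A> \<union> \<B>)" .
  have "card (insert z A) = Suc k" if "A \<in> \<A>" for A
    using that A z[of A] finV by auto
  then have "insert z ` \<A> \<union> \<B> \<subseteq> {P. P \<subseteq> insert z V \<and> card P = Suc k}"
    using A B by auto
  moreover have "intersecting (insert z ` \<A> \<union> \<B>)"
    using int cross unfolding intersecting_def by blast
  ultimately have "Suc (card V) * card (insert z ` \<A> \<union> \<B>) \<le> Suc k * (Suc (card V) choose Suc k)"
    using Erdos_Ko_Rado[of "insert z V" "Suc k" "insert z ` \<A> \<union> \<B>"] V r by simp
  also have "\<dots> = Suc (card V) * (card V choose k)"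
    by (rule Suc_times_binomial)
  finally show ?thesis unfolding eq by (simp del: mult_Suc)
qed

section \<open>Weighted intersecting families\<close>

text \<open>The combination of the two constraints on the level differences \<open>D\<close>: for \<open>2p \<le> n\<close>,
  \<open>u(p) D(p) + u(n - p) D(n - p) = u(n - p) (D(p) + D(n - p)) + (u(p) - u(n - p)) D(p)\<close>, and all
  factors on the right are nonnegative.\<close>

lemma weighted_pairing_nonneg:
  fixes u D :: "nat \<Rightarrow> real"
  assumes u: "\<And>p. p \<le> n \<Longrightarrow> 0 \<le> u p" "\<And>p. 2 * p \<le> n \<Longrightarrow> u (n - p) \<le> u p"
    and D: "\<And>p. 2 * p \<le> n \<Longrightarrow> 0 \<le> D p" "\<And>p. p \<le> n \<Longrightarrow> 0 \<le> D p + D (n - p)"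
  shows "0 \<le> (\<Sum>p\<le>n. u p * D p)"
proof -
  have half: "0 \<le> u p * D p + u (n - p) * D (n - p)" if "2 * p \<le> n" for p
  proof -
    have "0 \<le> u (n - p) * (D p + D (n - p))"
      using that u(1)[of "n - p"] D(2)[of p] by (intro mult_nonneg_nonneg) simp_all
    moreover have "0 \<le> (u p - u (n - p)) * D p"
      using that u(2)[of p] D(1)[of p] by (intro mult_nonneg_nonneg) simp_all
    ultimately show ?thesis by (simp add: algebra_simps)
  qed
  have "0 \<le> u p * D p + u (n - p) * D (n - p)" if "p \<le> n" for p
  proof (cases "2 * p \<le> n")
    case False
    then show ?thesis using half[of "n - p"] that by (simp add: add.commute)
  qed (rule half)
  then have "0 \<le> (\<Sum>p\<le>n. u p * D p + u (n - p) * D (n - p))"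
    by (intro sum_nonneg) auto
  also have "\<dots> = (\<Sum>p\<le>n. u p * D p) + (\<Sum>p\<le>n. u (n - p) * D (n - p))"
    by (rule sum.distrib)
  also have "(\<Sum>p\<le>n. u (n - p) * D (n - p)) = (\<Sum>p\<le>n. u p * D p)"
    by (rule sum.reindex_bij_witness[where i = "\<lambda>p. n - p" and j = "\<lambda>p. n - p"]) auto
  finally show ?thesis by simp
qed

text \<open>The quantity \<open>p / n * (n choose p)\<close> is the size of level \<open>p\<close> of a star. The weight of level \<open>p\<close>
  is \<open>(n - p) choose (n - r)\<close> rather than \<open>(n - p) choose (r - p)\<close>: both agree for \<open>p \<le> r\<close>, but the
  former vanishes for \<open>p > r\<close> and visibly decreases in \<open>p\<close>.\<close>

lemma weighted_levels_bound:
  fixes \<A> \<P> :: "'a set set" and V :: "'a set" and r :: nat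
  defines "n \<equiv> card V"
  assumes V: "finite V" "z \<notin> V" and r: "1 \<le> r" "r < n"
    and A: "\<A> \<subseteq> {A. A \<subseteq> V \<and> card A = r - 1}" and P: "\<P> \<subseteq> Pow V"
    and int: "intersecting \<P>"
    and cross: "\<And>A P. A \<in> \<A> \<Longrightarrow> P \<in> \<P> \<Longrightarrow> A \<inter> P \<noteq> {}"
  shows "real (card \<A>) + (\<Sum>p\<le>n. real ((n - p) choose (n - r)) * real (card {P \<in> \<P>. card P = p}))
    \<le> real (r - 1) / real n * real (n choose (r - 1))
      + (\<Sum>p\<le>n. real ((n - p) choose (n - r)) * (real p / real n * real (n choose p)))"
proof -
  define lev where "lev p = {P \<in> \<P>. card P = p}" for p
  define D where "D p = real p / real n * real (n choose p) - real (card (lev p))" for p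
  define w where "w p = real ((n - p) choose (n - r))" for p
  define m where "m = n - (r - 1)"
  have n: "0 < n" using r by simp
  have lev: "lev p \<subseteq> {Q. Q \<subseteq> V \<and> card Q = p}" "intersecting (lev p)" for p
    using P int by (auto simp: lev_def intersecting_def)
  have meet: "Q \<inter> R \<noteq> {}" if "Q \<in> lev p" "R \<in> lev q" for p q Q R
    using that int by (auto simp: lev_def intersecting_def)
  have crosslev: "A \<inter> R \<noteq> {}" if "A \<in> \<A>" "R \<in> lev q" for q A R
    using that cross by (auto simp: lev_def)
  have low: "0 \<le> D p" if "2 * p \<le> n" for p
  proof -
    have "n * card (lev p) \<le> p * (n choose p)"
      using Erdos_Ko_Rado[OF V(1) _ lev(1,2), of p] that by (simp add: n_def)
    then have "real n * real (card (lev p)) \<le> real p * real (n choose p)"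
      by (metis of_nat_le_iff of_nat_mult)
    then show ?thesis using n by (simp add: D_def field_simps)
  qed
  have share: "real p / real n * c + real (n - p) / real n * c = c" if "p \<le> n" for p c
    using that n by (simp add: field_simps)
  have pair: "0 \<le> D p + D (n - p)" if p: "p \<le> n" for p
  proof -
    have "card (lev p) + card (lev (n - p)) \<le> n choose p"
      using cross_intersecting_complementary_levels[OF V(1) _ lev(1) lev(1) meet, of p "n - p"] p
      by (simp add: n_def)
    then have "real (card (lev p)) + real (card (lev (n - p))) \<le> real (n choose p)"
      by linarith
    also have "\<dots> = real p / real n * real (n choose p) + real (n - p) / real n * real (n choose (n - p))"
      using share[OF p] binomial_symmetric[OF p] by simp
    finally show ?thesis by (simp add: D_def)
  qed
  have w_nonneg: "0 \<le> w p" for p by (simp add: w_def)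
  \<comment> \<open>the number of \<open>(r - 1)\<close>-sets outside a star, which is the largest possible surplus of \<open>\<A>\<close>\<close>
  have top: "real (n choose (r - 1)) - real (r - 1) / real n * real (n choose (r - 1))
      = real m / real n * real (n choose (r - 1))"
  proof -
    have "r - 1 \<le> n" using r by simp
    from share[OF this, of "real (n choose (r - 1))"] show ?thesis
      unfolding m_def by linarith
  qed
  have "real (card \<A>) - real (r - 1) / real n * real (n choose (r - 1)) \<le> (\<Sum>p\<le>n. w p * D p)"
  proof (cases "2 * r \<le> n + 1")
    case True
    have "card \<A> + card (lev r) \<le> n choose (r - 1)"
      using cross_intersecting_consecutive_levels[OF V, of "r - 1" \<A> "lev r"] A lev[of r] crosslev True r
      by (simp add: n_def)
    then have "real (card \<A>) + real (card (lev r)) \<le> real (n choose (r - 1))"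
      by linarith
    moreover have "real m * real (n choose (r - 1)) = real r * real (n choose r)"
    proof -
      have "m * (n choose (r - 1)) = r * (n choose r)"
        using binomial_absorb_comp[of n "r - 1"] binomial_absorption[of "r - 1" n] r
        by (simp add: m_def)
      then show ?thesis by (metis of_nat_mult)
    qed
    ultimately have "real (card \<A>) - real (r - 1) / real n * real (n choose (r - 1)) \<le> D r"
      using top by (simp add: D_def)
    also have "\<dots> = w r * D r" by (simp add: w_def)
    also have "\<dots> \<le> (\<Sum>p\<le>n. w p * D p)"
    proof (rule member_le_sum)
      fix p assume "p \<in> {..n} - {r}"
      then have "r < p \<and> p \<le> n \<or> 2 * p \<le> n" using True by auto
      then show "0 \<le> w p * D p"
      proof
        assume "r < p \<and> p \<le> n"
        then have "n - p < n - r" by linarith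
        then have "w p = 0" by (simp add: w_def binomial_eq_0)
        then show ?thesis by simp
      qed (use low w_nonneg in simp)
    qed (use r in auto)
    finally show ?thesis .
  next
    case False
    \<comment> \<open>one copy of level \<open>m\<close> is set aside to pay for the surplus of \<open>\<A>\<close>\<close>
    define u where "u p = w p - of_bool (p = m)" for p
    have m: "m \<le> n" "2 * m \<le> n" "n - m = r - 1" "m \<le> r" "0 < m"
      using r False by (auto simp: m_def)
    have "card \<A> + card (lev m) \<le> n choose (r - 1)"
      using cross_intersecting_complementary_levels[OF V(1) _ A lev(1) crosslev, of m] r
      by (simp add: n_def m_def)
    then have "real (card \<A>) + real (card (lev m)) \<le> real (n choose (r - 1))"
      by linarith
    moreover have "n choose (r - 1) = n choose m"
      using binomial_symmetric[OF m(1)] m by simp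
    ultimately have "real (card \<A>) - real (r - 1) / real n * real (n choose (r - 1)) \<le> D m"
      using top by (simp add: D_def)
    moreover have "0 \<le> (\<Sum>p\<le>n. u p * D p)"
    proof (rule weighted_pairing_nonneg)
      have w_m: "1 \<le> w m"
        using m r by (simp add: w_def Suc_le_eq zero_less_binomial_iff)
      show "0 \<le> u p" for p
        using w_m w_nonneg by (simp add: u_def)
      fix p assume p: "2 * p \<le> n"
      have mono: "w (n - p) \<le> w p"
        using p by (simp add: w_def binomial_right_mono)
      show "u (n - p) \<le> u p"
      \<comment> \<open>only the pair \<open>m < n - m\<close> loses weight on its heavier side; there strictness makes up for it\<close>
      proof (cases "p = m \<and> 2 * m < n")
        case True
        have "m choose (n - r) < (r - 1) choose (n - r)"
        proof -
          have "m choose (n - r) < Suc m choose (n - r)"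
          proof -
            obtain j where j: "n - r = Suc j" using r by (cases "n - r") auto
            then have "0 < m choose j" using r by (auto simp: m_def)
            then show ?thesis by (simp add: j)
          qed
          also have "\<dots> \<le> (r - 1) choose (n - r)"
            using True m by (intro binomial_right_mono) auto
          finally show ?thesis .
        qed
        moreover have "w (n - m) = real (m choose (n - r))"
          unfolding w_def by (simp only: diff_diff_cancel[OF m(1)])
        moreover have "w m = real ((r - 1) choose (n - r))"
          unfolding w_def by (simp only: m(3))
        ultimately have "w (n - m) + 1 \<le> w m" by linarith
        moreover have "n - m \<noteq> m" using True m(1) by linarith
        ultimately show ?thesis using True by (simp add: u_def)
      next
        case False
        then show ?thesis using mono p m by (auto simp: u_def)
      qed
    qed (use low pair in auto)
    moreover have "(\<Sum>p\<le>n. u p * D p) = (\<Sum>p\<le>n. w p * D p) - D m"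
    proof -
      have "(\<Sum>p\<le>n. u p * D p) = (\<Sum>p\<le>n. w p * D p - (if p = m then D p else 0))"
        by (intro sum.cong) (auto simp: u_def algebra_simps)
      also have "\<dots> = (\<Sum>p\<le>n. w p * D p) - (\<Sum>p\<le>n. if p = m then D p else 0)"
        by (rule sum_subtractf)
      finally show ?thesis using m by simp
    qed
    ultimately show ?thesis by linarith
  qed
  also have "(\<Sum>p\<le>n. w p * D p) = (\<Sum>p\<le>n. w p * (real p / real n * real (n choose p)))
      - (\<Sum>p\<le>n. w p * real (card (lev p)))"
    by (simp add: D_def right_diff_distrib sum_subtractf)
  finally show ?thesis by (simp add: w_def lev_def)
qed

lemma sum_by_card:
  fixes g :: "nat \<Rightarrow> 'b::comm_semiring_1"
  assumes V: "finite V" and P: "\<P> \<subseteq> Pow V"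
  shows "(\<Sum>P\<in>\<P>. g (card P)) = (\<Sum>p\<le>card V. g p * of_nat (card {P \<in> \<P>. card P = p}))"
proof -
  have fin: "finite \<P>" using V P finite_subset by blast
  have "card ` \<P> \<subseteq> {..card V}" using P V by (auto intro: card_mono)
  then have "(\<Sum>P\<in>\<P>. g (card P)) = (\<Sum>p\<le>card V. \<Sum>P\<in>{P \<in> \<P>. card P = p}. g (card P))"
    using fin by (intro sum.group[symmetric]) auto
  also have "\<dots> = (\<Sum>p\<le>card V. g p * of_nat (card {P \<in> \<P>. card P = p}))"
    by (intro sum.cong) (auto simp: mult.commute)
  finally show ?thesis .
qed

lemma card_subsets_through_point:
  assumes V: "finite V" "v \<in> V"
  shows "card V * card {P. P \<subseteq> V \<and> v \<in> P \<and> card P = p} = p * (card V choose p)"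
proof (cases p)
  case 0
  have "card P \<noteq> 0" if "P \<subseteq> V" "v \<in> P" for P
    using that finite_subset[OF that(1) V(1)] by auto
  then have none: "{P. P \<subseteq> V \<and> v \<in> P \<and> card P = p} = {}"
    using 0 by blast
  show ?thesis unfolding none by (simp add: 0)
next
  case (Suc k)
  have "bij_betw (insert v) {Q. Q \<subseteq> V - {v} \<and> card Q = k} {P. P \<subseteq> V \<and> v \<in> P \<and> card P = p}"
  proof (rule bij_betwI[where g = "\<lambda>P. P - {v}"])
    show "insert v \<in> {Q. Q \<subseteq> V - {v} \<and> card Q = k} \<rightarrow> {P. P \<subseteq> V \<and> v \<in> P \<and> card P = p}"
    proof
      fix Q assume Q: "Q \<in> {Q. Q \<subseteq> V - {v} \<and> card Q = k}"
      then have "finite Q" "v \<notin> Q" using V(1) finite_subset by blast+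
      then show "insert v Q \<in> {P. P \<subseteq> V \<and> v \<in> P \<and> card P = p}"
        using Q V(2) Suc by auto
    qed
    show "(\<lambda>P. P - {v}) \<in> {P. P \<subseteq> V \<and> v \<in> P \<and> card P = p} \<rightarrow> {Q. Q \<subseteq> V - {v} \<and> card Q = k}"
      using Suc by auto
  qed auto
  then have "card {P. P \<subseteq> V \<and> v \<in> P \<and> card P = p} = card {Q. Q \<subseteq> V - {v} \<and> card Q = k}"
    by (simp add: bij_betw_same_card)
  also have "\<dots> = (card V - 1) choose k"
    using V by (simp add: n_subsets)
  finally show ?thesis
    using Suc binomial_absorption[of k "card V"] by (simp del: mult_Suc)
qed

text \<open>The previous bound in its combinatorial form, with the level sizes of the star at \<open>v\<close>
  summed up again.\<close>

lemma weighted_star_bound: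
  fixes \<A> \<P> :: "'a set set" and V :: "'a set" and r :: nat
  defines "w P \<equiv> (card V - card P) choose (card V - r)"
  assumes V: "finite V" "z \<notin> V" and v: "v \<in> V" and r: "1 \<le> r" "r < card V"
    and A: "\<A> \<subseteq> {A. A \<subseteq> V \<and> card A = r - 1}" and P: "\<P> \<subseteq> Pow V"
    and int: "intersecting \<P>"
    and cross: "\<And>A P. A \<in> \<A> \<Longrightarrow> P \<in> \<P> \<Longrightarrow> A \<inter> P \<noteq> {}"
  shows "card \<A> + sum w \<P> \<le> card {A. A \<subseteq> V \<and> v \<in> A \<and> card A = r - 1} + sum w {P. P \<subseteq> V \<and> v \<in> P}"
proof -
  let ?n = "card V"
  let ?W = "\<lambda>p. real ((?n - p) choose (?n - r))"
  have n: "0 < ?n" using r by simp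
  have star: "real (card {P. P \<subseteq> V \<and> v \<in> P \<and> card P = p}) = real p / real ?n * real (?n choose p)" for p
  proof -
    have "real ?n * real (card {P. P \<subseteq> V \<and> v \<in> P \<and> card P = p}) = real p * real (?n choose p)"
      using card_subsets_through_point[OF V(1) v, of p] by (metis of_nat_mult)
    then show ?thesis using n by (simp add: field_simps)
  qed
  have sumw: "real (sum w \<G>) = (\<Sum>p\<le>?n. ?W p * real (card {P \<in> \<G>. card P = p}))"
    if "\<G> \<subseteq> Pow V" for \<G>
    using sum_by_card[OF V(1) that, of ?W] by (simp add: w_def)
  have "real (card \<A>) + real (sum w \<P>)
      \<le> real (r - 1) / real ?n * real (?n choose (r - 1)) + (\<Sum>p\<le>?n. ?W p * (real p / real ?n * real (?n choose p)))"
    unfolding sumw[OF P] by (rule weighted_levels_bound[OF V r A P int cross])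
  also have "\<dots> = real (card {A. A \<subseteq> V \<and> v \<in> A \<and> card A = r - 1}) + real (sum w {P. P \<subseteq> V \<and> v \<in> P})"
  proof -
    have "{P. P \<subseteq> V \<and> v \<in> P} \<subseteq> Pow V" by blast
    from sumw[OF this] show ?thesis unfolding star[symmetric] by (simp add: conj_assoc)
  qed
  finally show ?thesis by linarith
qed

section \<open>Independent sets of the depth-two claw\<close>

abbreviation claw_sets :: "nat \<Rightarrow> nat \<Rightarrow> claw_vertex set set" where
  "claw_sets n r \<equiv> independent_sets (depth_two_claw n) r"

lemma claw_sets_iff:
  "B \<in> claw_sets n r \<longleftrightarrow>
    B \<subseteq> X ` {0..n} \<union> Y ` {1..n} \<and> card B = r \<and> (\<forall>i. Y i \<in> B \<longrightarrow> X i \<notin> B \<and> X 0 \<notin> B)"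
proof -
  have "finite B" if "B \<subseteq> X ` {0..n} \<union> Y ` {1..n}"
    using that by (rule finite_subset) simp
  moreover have "(\<forall>u\<in>B. \<forall>v\<in>B. u \<noteq> v \<longrightarrow> \<not> adjacent (depth_two_claw n) u v)
      \<longleftrightarrow> (\<forall>i. Y i \<in> B \<longrightarrow> X i \<notin> B \<and> X 0 \<notin> B)"
    if "B \<subseteq> X ` {0..n} \<union> Y ` {1..n}"
  proof -
    have adj: "adjacent (depth_two_claw n) u v \<longleftrightarrow>
        (\<exists>i\<in>{1..n}. {u, v} = {X 0, Y i} \<or> {u, v} = {X i, Y i})" for u v
      unfolding adjacent_def edges_def depth_two_claw_def by auto
    show ?thesis
    proof (intro iffI allI impI ballI)
      fix i assume ind: "\<forall>u\<in>B. \<forall>v\<in>B. u \<noteq> v \<longrightarrow> \<not> adjacent (depth_two_claw n) u v" and i: "Y i \<in> B"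
      then have "i \<in> {1..n}" using that by auto
      then have "adjacent (depth_two_claw n) (X i) (Y i)" "adjacent (depth_two_claw n) (X 0) (Y i)"
        unfolding adj by blast+
      then show "X i \<notin> B \<and> X 0 \<notin> B" using ind i by blast
    next
      fix u v assume ok: "\<forall>i. Y i \<in> B \<longrightarrow> X i \<notin> B \<and> X 0 \<notin> B" and "u \<in> B" "v \<in> B"
      then have "{u, v} \<subseteq> B" by simp
      moreover have "\<not> {X 0, Y i} \<subseteq> B" "\<not> {X i, Y i} \<subseteq> B" for i using ok by auto
      ultimately show "\<not> adjacent (depth_two_claw n) u v" unfolding adj by metis
    qed
  qed
  ultimately show ?thesis
    unfolding independent_sets_def independent_set_def
    by (auto simp: verts_def depth_two_claw_def)
qed

lemma finite_claw_sets: "finite (claw_sets n r)"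
  by (rule finite_subset[of _ "Pow (X ` {0..n} \<union> Y ` {1..n})"]) (auto simp: claw_sets_iff)

lemma finite_claw_set: "B \<in> claw_sets n r \<Longrightarrow> finite B"
  by (simp add: independent_sets_def)

section \<open>Compression towards the vertices X\<close>

definition push :: "nat \<Rightarrow> claw_vertex set \<Rightarrow> claw_vertex set" where
  "push i B = (if Y i \<in> B then insert (X i) (B - {Y i}) else B)"

lemma push_in_claw_sets:
  assumes B: "B \<in> claw_sets n r"
  shows "push i B \<in> claw_sets n r"
proof (cases "Y i \<in> B")
  case True
  have B': "B \<subseteq> X ` {0..n} \<union> Y ` {1..n}" "card B = r" "\<And>j. Y j \<in> B \<Longrightarrow> X j \<notin> B \<and> X 0 \<notin> B"
    using B by (auto simp: claw_sets_iff)
  have i: "i \<in> {1..n}" using True B'(1) by auto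
  have "card (insert (X i) (B - {Y i})) = r"
    using True B'(2,3) finite_claw_set[OF B] by (simp add: card.insert_remove card_Suc_Diff1 del: card_Diff_insert)
  then show ?thesis using True B'(1,3) i by (auto simp: push_def claw_sets_iff)
qed (use B in \<open>simp add: push_def\<close>)

lemma push_injective:
  assumes "B \<in> claw_sets n r" "C \<in> claw_sets n r" "push i B \<noteq> B" "push i C \<noteq> C" "push i B = push i C"
  shows "B = C"
proof -
  have Y: "Y i \<in> B" "Y i \<in> C" using assms(3,4) by (auto simp: push_def split: if_splits)
  then have "X i \<notin> B" "X i \<notin> C" using assms(1,2) by (auto simp: claw_sets_iff)
  then have "B - {Y i} = C - {Y i}"
    using assms(5) Y by (simp add: push_def) (metis DiffD1 insert_ident)
  then show ?thesis using Y by blast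
qed

text \<open>A member moves only if its image is not already present, so that no two members are merged.\<close>

definition compress :: "nat \<Rightarrow> claw_vertex set set \<Rightarrow> claw_vertex set \<Rightarrow> claw_vertex set" where
  "compress i \<E> B = (if push i B \<in> \<E> then B else push i B)"

lemma inj_on_compress:
  assumes "\<E> \<subseteq> claw_sets n r"
  shows "inj_on (compress i \<E>) \<E>"
proof (rule inj_onI)
  fix B C assume BC: "B \<in> \<E>" "C \<in> \<E>" "compress i \<E> B = compress i \<E> C"
  then show "B = C"
    using assms push_injective[of B n r C i] unfolding compress_def by (metis subsetD)
qed

text \<open>Two moved members share \<open>X i\<close>. If \<open>B\<close> moves and \<open>C\<close> stays because \<open>push i C\<close> is present, take a
  common element of \<open>B\<close> and \<open>push i C\<close>: it is neither \<open>X i\<close>, which the independent set \<open>B\<close>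
  containing \<open>Y i\<close> avoids, nor \<open>Y i\<close>, which \<open>push i C\<close> avoids, and so the moves leave it alone.\<close>

lemma intersecting_compress:
  assumes E: "\<E> \<subseteq> claw_sets n r" and int: "intersecting \<E>"
  shows "intersecting (compress i \<E> ` \<E>)"
proof -
  have meet: "B \<inter> C \<noteq> {}" if "B \<in> \<E>" "C \<in> \<E>" for B C
    using int that by (auto simp: intersecting_def)
  have mixed: "push i B \<inter> C \<noteq> {}"
    if B: "B \<in> \<E>" "push i B \<notin> \<E>" and C: "C \<in> \<E>" "push i C \<in> \<E>" for B C
  proof -
    have YB: "Y i \<in> B" using B by (auto simp: push_def split: if_splits)
    then have XB: "X i \<notin> B" using B(1) E by (auto simp: claw_sets_iff)
    obtain z where z: "z \<in> B" "z \<in> push i C" using meet[OF B(1) C(2)] by blast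
    then have "z \<noteq> X i" "z \<noteq> Y i" using XB by (auto simp: push_def split: if_splits)
    then show ?thesis using z YB by (auto simp: push_def split: if_splits)
  qed
  have "compress i \<E> B \<inter> compress i \<E> C \<noteq> {}" if BC: "B \<in> \<E>" "C \<in> \<E>" for B C
  proof (cases "push i B \<in> \<E>"; cases "push i C \<in> \<E>")
    assume "push i B \<notin> \<E>" "push i C \<notin> \<E>"
    then have "X i \<in> push i B" "X i \<in> push i C"
      using BC by (auto simp: push_def split: if_splits)
    then show ?thesis using \<open>push i B \<notin> \<E>\<close> \<open>push i C \<notin> \<E>\<close> by (auto simp: compress_def)
  next
    assume "push i B \<in> \<E>" "push i C \<notin> \<E>"
    then show ?thesis using mixed[of C B] BC by (simp add: compress_def Int_commute)
  qed (use BC meet mixed in \<open>simp_all add: compress_def\<close>)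
  then show ?thesis by (auto simp: intersecting_def)
qed

text \<open>Among the intersecting families of the given size, one with the largest total number of
  \<open>X\<close>-vertices is stable: a compression that moved a member would increase that number.\<close>

lemma exists_compressed_family:
  assumes E: "\<E> \<subseteq> claw_sets n r" and int: "intersecting \<E>"
  obtains \<E>' where "\<E>' \<subseteq> claw_sets n r" "intersecting \<E>'" "card \<E>' = card \<E>"
    and "\<And>i B. B \<in> \<E>' \<Longrightarrow> push i B \<in> \<E>'"
proof -
  define \<Omega> where "\<Omega> = {\<F>. \<F> \<subseteq> claw_sets n r \<and> intersecting \<F> \<and> card \<F> = card \<E>}"
  define \<phi> where "\<phi> \<F> = (\<Sum>B\<in>\<F>. card (X -` B))" for \<F>
  have "finite \<Omega>"
    by (rule finite_subset[of _ "Pow (claw_sets n r)"]) (auto simp: \<Omega>_def finite_claw_sets)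
  moreover have "\<E> \<in> \<Omega>" using assms by (simp add: \<Omega>_def)
  ultimately have "Max (\<phi> ` \<Omega>) \<in> \<phi> ` \<Omega>" "\<And>\<G>. \<G> \<in> \<Omega> \<Longrightarrow> \<phi> \<G> \<le> Max (\<phi> ` \<Omega>)"
    by (auto intro!: Max_in)
  then obtain \<F> where F: "\<F> \<in> \<Omega>" and max: "\<And>\<G>. \<G> \<in> \<Omega> \<Longrightarrow> \<phi> \<G> \<le> \<phi> \<F>"
    by (metis imageE)
  have FI: "\<F> \<subseteq> claw_sets n r" "intersecting \<F>" "card \<F> = card \<E>"
    using F by (simp_all add: \<Omega>_def)
  have finF: "finite \<F>" using FI(1) finite_claw_sets finite_subset by blast
  have "push i B \<in> \<F>" if B: "B \<in> \<F>" for i B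
  proof (rule ccontr)
    assume out: "push i B \<notin> \<F>"
    have inj: "inj_on (compress i \<F>) \<F>" using FI(1) by (rule inj_on_compress)
    have "compress i \<F> B \<in> claw_sets n r" if "B \<in> \<F>" for B
      using FI(1) push_in_claw_sets that by (auto simp: compress_def)
    then have "compress i \<F> ` \<F> \<in> \<Omega>"
      using FI(3) intersecting_compress[OF FI(1,2)] card_image[OF inj] by (simp add: \<Omega>_def image_subset_iff)
    then have "\<phi> (compress i \<F> ` \<F>) \<le> \<phi> \<F>" by (rule max)
    moreover have "\<phi> \<F> < (\<Sum>C\<in>\<F>. card (X -` compress i \<F> C))"
      unfolding \<phi>_def
    proof (rule sum_strict_mono_ex1[OF finF])
      have gain: "X -` push i C = insert i (X -` C) \<and> i \<notin> X -` C \<and> finite (X -` C)"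
        if C: "C \<in> \<F>" "push i C \<notin> \<F>" for C
      proof -
        have "Y i \<in> C" using C by (auto simp: push_def split: if_splits)
        moreover have "X i \<notin> C" using C(1) FI(1) calculation by (auto simp: claw_sets_iff)
        moreover have "finite C" using C(1) FI(1) finite_claw_set by blast
        ultimately show ?thesis
          by (auto simp: push_def finite_vimageI inj_on_def)
      qed
      show "\<forall>C\<in>\<F>. card (X -` C) \<le> card (X -` compress i \<F> C)"
        using gain by (auto simp: compress_def)
      show "\<exists>C\<in>\<F>. card (X -` C) < card (X -` compress i \<F> C)"
        using gain[OF B out] B out by (intro bexI[of _ B]) (auto simp: compress_def)
    qed
    ultimately show False
      using inj by (simp add: \<phi>_def sum.reindex)
  qed
  then show ?thesis using that FI by blast
qed

text \<open>If \<open>B\<close> and \<open>C\<close> met only in \<open>Y\<close>-vertices, pushing one of these in \<open>B\<close> alone would give a member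
  that meets \<open>C\<close> in one element less: the new \<open>X i\<close> is not in \<open>C\<close>, as \<open>Y i\<close> is. Repeating
  this ends with two disjoint members.\<close>

lemma compressed_families_share_X:
  assumes E: "\<E> \<subseteq> claw_sets n r" and int: "intersecting \<E>"
    and push: "\<And>i B. B \<in> \<E> \<Longrightarrow> push i B \<in> \<E>"
    and BC: "B \<in> \<E>" "C \<in> \<E>"
  shows "X -` B \<inter> X -` C \<noteq> {}"
  using BC(1)
proof (induction "card (B \<inter> C)" arbitrary: B rule: less_induct)
  case less
  show ?case
  proof (rule ccontr)
    assume no_X: "\<not> X -` B \<inter> X -` C \<noteq> {}"
    obtain z where z: "z \<in> B" "z \<in> C" using int less.prems BC(2) by (auto simp: intersecting_def)
    then obtain i where i: "Y i \<in> B" "Y i \<in> C" using no_X by (cases z) auto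
    then have "X i \<notin> C" using BC(2) E by (auto simp: claw_sets_iff)
    then have eq: "push i B \<inter> C = B \<inter> C - {Y i}" "X -` push i B \<inter> X -` C = X -` B \<inter> X -` C"
      using i by (auto simp: push_def)
    have "finite (B \<inter> C)" using BC(2) E finite_claw_set by blast
    then have "card (push i B \<inter> C) < card (B \<inter> C)"
      unfolding eq(1) using i by (intro card_Diff1_less) auto
    then show False
      using less.hyps[of "push i B"] push[OF less.prems] eq(2) no_X by simp
  qed
qed

section \<open>Fibers over the index sets of the X-vertices\<close>

definition fiber :: "nat \<Rightarrow> nat \<Rightarrow> nat set \<Rightarrow> claw_vertex set set" where
  "fiber n r P = {B \<in> claw_sets n r. X -` B = P}"

lemma split_XY: "B = X ` (X -` B) \<union> Y ` (Y -` B)"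
proof (intro set_eqI)
  show "v \<in> B \<longleftrightarrow> v \<in> X ` (X -` B) \<union> Y ` (Y -` B)" for v by (cases v) auto
qed

lemma card_XY:
  assumes "finite P" "finite Q"
  shows "card (X ` P \<union> Y ` Q) = card P + card Q"
  using assms by (subst card_Un_disjoint) (auto simp: card_image inj_on_def)

text \<open>A member of the fiber arises from \<open>P\<close> by choosing \<open>r - card P\<close> indices outside \<open>P\<close> for the
  \<open>Y\<close>-vertices. For \<open>card P > r\<close> both sides are \<open>0\<close>, as \<open>r < n\<close>.\<close>

lemma card_fiber:
  assumes P: "P \<subseteq> {1..n}" and r: "r < n"
  shows "card (fiber n r P) = (n - card P) choose (n - r)"
proof (cases "card P \<le> r")
  case True
  have finP: "finite P" using P finite_subset by blast
  have "bij_betw (\<lambda>Q. X ` P \<union> Y ` Q) {Q. Q \<subseteq> {1..n} - P \<and> card Q = r - card P} (fiber n r P)"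
  proof (rule bij_betwI[where g = "\<lambda>B. Y -` B"])
    show "(\<lambda>Q. X ` P \<union> Y ` Q) \<in> {Q. Q \<subseteq> {1..n} - P \<and> card Q = r - card P} \<rightarrow> fiber n r P"
    proof
      fix Q assume Q: "Q \<in> {Q. Q \<subseteq> {1..n} - P \<and> card Q = r - card P}"
      then have "finite Q" using finite_subset by blast
      then have "card (X ` P \<union> Y ` Q) = r" using Q True finP by (simp add: card_XY)
      then show "X ` P \<union> Y ` Q \<in> fiber n r P"
        using P Q by (auto simp: fiber_def claw_sets_iff)
    qed
    show "(\<lambda>B. Y -` B) \<in> fiber n r P \<rightarrow> {Q. Q \<subseteq> {1..n} - P \<and> card Q = r - card P}"
    proof
      fix B assume "B \<in> fiber n r P"
      then have B: "B \<in> claw_sets n r" "X -` B = P" by (auto simp: fiber_def)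
      have "card B = card P + card (Y -` B)"
        using split_XY[of B] card_XY[OF finP, of "Y -` B"] finite_claw_set[OF B(1)] B(2)
        by (simp add: finite_vimageI inj_on_def)
      then show "Y -` B \<in> {Q. Q \<subseteq> {1..n} - P \<and> card Q = r - card P}"
        using B by (auto simp: claw_sets_iff)
    qed
    show "Y -` (X ` P \<union> Y ` Q) = Q" for Q by auto
    show "X ` P \<union> Y ` (Y -` B) = B" if "B \<in> fiber n r P" for B
      using that split_XY[of B] by (simp add: fiber_def)
  qed
  then have "card (fiber n r P) = card {Q. Q \<subseteq> {1..n} - P \<and> card Q = r - card P}"
    by (simp add: bij_betw_same_card)
  also have "\<dots> = (n - card P) choose (r - card P)"
    using P finP by (simp add: n_subsets card_Diff_subset)
  also have "\<dots> = (n - card P) choose (n - r)"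
    using True r by (subst binomial_symmetric) simp_all
  finally show ?thesis .
next
  case False
  have "fiber n r P = {}"
  proof (rule ccontr)
    assume "fiber n r P \<noteq> {}"
    then obtain B where B: "B \<in> claw_sets n r" "X -` B = P" by (auto simp: fiber_def)
    then have "card (X ` P) \<le> card B" using finite_claw_set by (intro card_mono) auto
    then show False using False B(1) by (simp add: claw_sets_iff card_image inj_on_def)
  qed
  moreover have "n - card P < n - r" using False r by linarith
  ultimately show ?thesis by (simp add: binomial_eq_0)
qed

text \<open>The root \<open>X 0\<close> is adjacent to every \<open>Y\<close>-vertex, so no choice is left.\<close>

lemma fiber_root:
  assumes "0 \<in> P"
  shows "fiber n r P = (if P \<subseteq> {0..n} \<and> card P = r then {X ` P} else {})"
proof -
  have "B = X ` P \<and> P \<subseteq> {0..n} \<and> card P = r" if "B \<in> fiber n r P" for B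
  proof -
    have B: "B \<in> claw_sets n r" "X -` B = P" using that by (auto simp: fiber_def)
    then have "Y -` B = {}" using assms by (auto simp: claw_sets_iff)
    then have "B = X ` P" using split_XY[of B] B(2) by simp
    then show ?thesis using B by (auto simp: claw_sets_iff card_image inj_on_def)
  qed
  moreover have "X ` P \<in> fiber n r P" if "P \<subseteq> {0..n}" "card P = r"
    using that by (auto simp: fiber_def claw_sets_iff card_image inj_on_def)
  ultimately show ?thesis by auto
qed

lemma card_Union_fibers:
  assumes "finite \<G>"
  shows "card (\<Union>P\<in>\<G>. fiber n r P) = (\<Sum>P\<in>\<G>. card (fiber n r P))"
  using assms finite_claw_sets by (intro card_UN_disjoint) (auto simp: fiber_def)

section \<open>The star at X 1 is a largest intersecting family\<close>

text \<open>After compression, a family is bounded by the fibers over its index sets, and the star at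
  \<open>X 1\<close> contains all fibers over the index sets through \<open>1\<close>. The weighted bound is applied
  with the root index \<open>0\<close> as the point outside \<open>V = {1..n}\<close>.\<close>

lemma card_intersecting_le_star:
  assumes r: "1 \<le> r" "r < n" and E: "\<E> \<subseteq> claw_sets n r" and int: "intersecting \<E>"
  shows "card \<E> \<le> card {B \<in> claw_sets n r. X 1 \<in> B}"
proof -
  obtain \<F> where F: "\<F> \<subseteq> claw_sets n r" "intersecting \<F>" "card \<F> = card \<E>"
    and push: "\<And>i B. B \<in> \<F> \<Longrightarrow> push i B \<in> \<F>"
    using exists_compressed_family[OF E int] by metis
  define w where "w P = (n - card P) choose (n - r)" for P :: "nat set"
  define \<G> where "\<G> = (\<lambda>B. X -` B) ` \<F>"
  define \<P> where "\<P> = {P \<in> \<G>. 0 \<notin> P}"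
  define \<R> where "\<R> = {P \<in> \<G>. 0 \<in> P}"
  define \<A> where "\<A> = (\<lambda>P. P - {0}) ` \<R>"
  define SP where "SP = {P. P \<subseteq> {1..n} \<and> 1 \<in> P}"
  define SA where "SA = {A. A \<subseteq> {1..n} \<and> 1 \<in> A \<and> card A = r - 1}"
  have X_range: "X -` B \<subseteq> {0..n}" if "B \<in> \<F>" for B
  proof -
    have "B \<in> claw_sets n r" using that F(1) by blast
    then show ?thesis by (auto simp: claw_sets_iff)
  qed
  then have G: "\<G> \<subseteq> Pow {0..n}" by (auto simp: \<G>_def)
  then have finG: "finite \<G>" using finite_subset by blast
  have meet: "P \<inter> Q \<noteq> {}" if "P \<in> \<G>" "Q \<in> \<G>" for P Q
    using that compressed_families_share_X[OF F(1,2) push] by (auto simp: \<G>_def)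
  have avoid_root: "P \<subseteq> {1..n}" if "P \<subseteq> {0..n}" "0 \<notin> P" for P
  proof
    fix x assume "x \<in> P"
    then show "x \<in> {1..n}" using that by (cases x) auto
  qed
  have P: "\<P> \<subseteq> Pow {1..n}" using G avoid_root unfolding \<P>_def by blast
  have R: "P \<subseteq> {0..n} \<and> 0 \<in> P \<and> card P = r" if "P \<in> \<R>" for P
  proof -
    from that obtain B where B: "B \<in> \<F>" "P = X -` B" "0 \<in> P" by (auto simp: \<R>_def \<G>_def)
    then have "B \<in> fiber n r P" using F(1) by (auto simp: fiber_def)
    then show ?thesis using B(3) fiber_root[OF B(3)] by (auto split: if_splits)
  qed
  have A: "\<A> \<subseteq> {A. A \<subseteq> {1..n} \<and> card A = r - 1}"
  proof
    fix A assume "A \<in> \<A>"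
    then obtain P where "P \<in> \<R>" "A = P - {0}" by (auto simp: \<A>_def)
    then show "A \<in> {A. A \<subseteq> {1..n} \<and> card A = r - 1}"
      using R[of P] avoid_root[of A] by auto
  qed
  have card_A: "card \<A> = card \<R>"
    unfolding \<A>_def by (rule card_image) (auto simp: inj_on_def \<R>_def)
  have int_P: "intersecting \<P>"
    using meet unfolding intersecting_def \<P>_def by simp
  have cross: "A \<inter> P \<noteq> {}" if "A \<in> \<A>" "P \<in> \<P>" for A P
  proof -
    from that(1) obtain Q where Q: "Q \<in> \<R>" "A = Q - {0}" unfolding \<A>_def by blast
    then have "Q \<inter> P \<noteq> {}" "0 \<notin> P"
      using meet[of Q P] that(2) unfolding \<R>_def \<P>_def by blast+
    then show ?thesis using Q(2) by blast
  qed
  have "card \<E> \<le> (\<Sum>P\<in>\<G>. card (fiber n r P))"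
  proof -
    have "\<F> \<subseteq> (\<Union>P\<in>\<G>. fiber n r P)" using F(1) by (auto simp: \<G>_def fiber_def)
    then have "card \<F> \<le> card (\<Union>P\<in>\<G>. fiber n r P)"
      by (rule card_mono[rotated]) (use finG finite_claw_sets in \<open>auto simp: fiber_def\<close>)
    then show ?thesis using F(3) card_Union_fibers[OF finG] by simp
  qed
  also have "\<dots> = (\<Sum>P\<in>\<R>. card (fiber n r P)) + (\<Sum>P\<in>\<P>. card (fiber n r P))"
  proof -
    have "\<G> = \<R> \<union> \<P>" "\<R> \<inter> \<P> = {}" by (auto simp: \<R>_def \<P>_def)
    then show ?thesis using finG by (simp add: sum.union_disjoint)
  qed
  also have "(\<Sum>P\<in>\<R>. card (fiber n r P)) = card \<A>"
  proof -
    have "card (fiber n r P) = 1" if "P \<in> \<R>" for P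
      using R[OF that] by (simp add: fiber_root)
    then show ?thesis by (simp add: card_A)
  qed
  also have "(\<Sum>P\<in>\<P>. card (fiber n r P)) = sum w \<P>"
    by (intro sum.cong) (use P r in \<open>auto simp: card_fiber w_def\<close>)
  also have "card \<A> + sum w \<P> \<le> card SA + sum w SP"
    using weighted_star_bound[of "{1..n}" 0 1 r \<A> \<P>] r A P int_P cross
    by (simp add: w_def SA_def SP_def)
  also have "\<dots> = (\<Sum>P \<in> insert 0 ` SA \<union> SP. card (fiber n r P))"
  proof -
    have no_root: "0 \<notin> P" if "P \<in> SA \<union> SP" for P using that by (auto simp: SA_def SP_def)
    have inj: "inj_on (insert 0) SA"
      using no_root by (intro inj_onI) (metis Un_iff insert_ident)
    have disj: "insert 0 ` SA \<inter> SP = {}"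
      using no_root by blast
    have "SA \<subseteq> Pow {1..n}" "SP \<subseteq> Pow {1..n}" by (auto simp: SA_def SP_def)
    then have fin: "finite SA" "finite SP" using finite_subset by blast+
    have "card (fiber n r (insert 0 A)) = 1" if "A \<in> SA" for A
    proof -
      have "finite A" "0 \<notin> A" "A \<subseteq> {0..n}" "card A = r - 1"
        using that by (auto simp: SA_def intro: finite_subset)
      then show ?thesis using r by (simp add: fiber_root)
    qed
    then have "(\<Sum>P \<in> insert 0 ` SA. card (fiber n r P)) = card SA"
      using inj by (simp add: sum.reindex)
    moreover have "(\<Sum>P\<in>SP. card (fiber n r P)) = sum w SP"
      by (intro sum.cong) (use r in \<open>auto simp: card_fiber w_def SP_def\<close>)
    ultimately show ?thesis using fin disj by (simp add: sum.union_disjoint)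
  qed
  also have "\<dots> = card (\<Union>P \<in> insert 0 ` SA \<union> SP. fiber n r P)"
  proof (rule card_Union_fibers[symmetric])
    have "insert 0 ` SA \<union> SP \<subseteq> Pow {0..n}" by (auto simp: SA_def SP_def)
    then show "finite (insert 0 ` SA \<union> SP)" by (rule finite_subset) simp
  qed
  also have "\<dots> \<le> card {B \<in> claw_sets n r. X 1 \<in> B}"
  proof (rule card_mono)
    show "finite {B \<in> claw_sets n r. X 1 \<in> B}" by (simp add: finite_claw_sets)
    show "(\<Union>P \<in> insert 0 ` SA \<union> SP. fiber n r P) \<subseteq> {B \<in> claw_sets n r. X 1 \<in> B}"
      by (auto simp: fiber_def SA_def SP_def)
  qed
  finally show ?thesis .
qed

theorem theorem1p5:
  fixes n r :: nat
  assumes "1 \<le> r" and "r \<le> n - 1"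
  shows "star_property (independent_sets (depth_two_claw n) r) \<and>
         (\<exists>v \<in> verts (depth_two_claw n).
            {A \<in> independent_sets (depth_two_claw n) r. v \<in> A} \<noteq> {} \<and>
            (\<forall>\<E>. \<E> \<subseteq> independent_sets (depth_two_claw n) r \<and> intersecting \<E> \<longrightarrow>
                 card \<E> \<le> card {A \<in> independent_sets (depth_two_claw n) r. v \<in> A}))"
proof -
  have r: "1 \<le> r" "r < n" using assms by auto
  let ?S = "{A \<in> claw_sets n r. X 1 \<in> A}"
  have "X ` {1..r} \<in> ?S"
    using r by (auto simp: claw_sets_iff card_image inj_on_def)
  then have nonempty: "?S \<noteq> {}" by blast
  have largest: "card \<E> \<le> card ?S" if "\<E> \<subseteq> claw_sets n r" "intersecting \<E>" for \<E>
    using card_intersecting_le_star[OF r that] .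
  have "intersecting ?S" by (auto simp: intersecting_def)
  then have "largest_intersecting (claw_sets n r) ?S"
    using largest by (auto simp: largest_intersecting_def)
  moreover have "is_star (claw_sets n r) ?S"
    using nonempty unfolding is_star_def members_with_def by blast
  ultimately have "star_property (claw_sets n r)"
    unfolding star_property_def by blast
  moreover have "X 1 \<in> verts (depth_two_claw n)"
    using r by (auto simp: verts_def depth_two_claw_def)
  ultimately show ?thesis using nonempty largest by blast
qed

end
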